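(* Let $r\geq 3$. Then $\kappa_2(O^{-}(2r,2))=3(2^{2r-3}+2^{r-2})-3=2k-\lambda-3$, where $k=2^{2r-2}+2^{r-1}$ and $\lambda=2^{2r-3}+2^{r-2}$.
   Context: Let $M$ be the $2r\times 2r$ block diagonal matrix over $\mathbb{F}_2$ all of whose diagonal blocks are $\begin{bmatrix}0&-1\\1&0\end{bmatrix}$. The elliptic quadric graph $O^{-}(2r,2)$ has vertex set $V^{-}=\{(x_1,\dots,x_{2r})^t\in\mathbb{F}_2^{2r}: x_1^2+x_2^2+x_1x_2+x_3x_4+\dots+x_{2r-1}x_{2r}=1\}$, with $x$ adjacent to $y$ if and only if $x^tMy=1$. It is strongly regular with parameters $(v,k,\lambda,\mu)=(2^{2r-1}+2^{r-1},2^{2r-2}+2^{r-1},2^{2r-3}+2^{r-2},2^{2r-3}+2^{r-1})$: $v$ vertices, $k$-regular, adjacent vertices have $\lambda$ common neighbors and distinct non-adjacent vertices have $\mu$ common neighbors. A disconnecting set of a connected graph $G$ is a set $S$ of vertices such that $G\setminus S$ is disconnected. $\kappa_2(G)$ denotes the minimum size of a disconnecting set $S$ of $G$ such that every component of $G\setminus S$ has at least two vertices. *)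

theory Defs
  imports
    "Jordan_Normal_Form.Matrix"
    "HOL-Library.Z2"
    "HOL-Library.Extended_Nat"
    "Graph_Theory.Digraph_Component"
begin

text \<open>
  Vectors and matrices over the two-element field \<^typ>\<open>bit\<close>. Indices start at \<open>0\<close>, so the
  coordinate \<open>x\<^sub>j\<close> of the mathematical text is \<open>x $ (j - 1)\<close>.
\<close>

definition M_form :: "nat \<Rightarrow> bit mat" where
  "M_form r = diag_block_mat (replicate r (mat_of_rows_list 2 [[0, -1], [1, 0]]))"

definition elliptic_quadric :: "nat \<Rightarrow> bit vec set" where
  "elliptic_quadric r = {x \<in> carrier_vec (2 * r).
     (x $ 0)\<^sup>2 + (x $ 1)\<^sup>2 + (\<Sum>i<r. x $ (2 * i) * x $ (2 * i + 1)) = 1}"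

text \<open>
  Undirected graphs are symmetric digraphs, as usual in \<^theory>\<open>Graph_Theory.Digraph\<close>:
  an edge is a pair of opposite arcs. The arc relation below is symmetric and loop-free
  because \<open>M_form r\<close> is alternating over \<^typ>\<open>bit\<close>.
\<close>

definition elliptic_quadric_graph :: "nat \<Rightarrow> bit vec pair_pre_digraph" where
  "elliptic_quadric_graph r =
    \<lparr> pverts = elliptic_quadric r,
      parcs = {(x, y). x \<in> elliptic_quadric r \<and> y \<in> elliptic_quadric r
                \<and> x \<bullet> (M_form r *\<^sub>v y) = 1} \<rparr>"

text \<open>
  The empty graph is not \<^const>\<open>Digraph_Component.connected\<close>; the nonemptiness condition
  keeps the full vertex set from counting as a disconnecting set.
\<close>

definition disconnecting_set :: "('a, 'b) pre_digraph \<Rightarrow> 'a set \<Rightarrow> bool" where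
  "disconnecting_set G S \<longleftrightarrow>
     S \<subseteq> verts G \<and> verts G - S \<noteq> {} \<and> \<not> Digraph_Component.connected (G \<restriction> (verts G - S))"

text \<open>
  For finite graphs. For a symmetric digraph the strongly connected components
  (\<^const>\<open>pre_digraph.sccs\<close>) are the connected components of the undirected graph.
  The infimum in \<^typ>\<open>enat\<close> is attained unless no admissible set exists, in which case the
  value is \<open>\<infinity>\<close>; so \<open>kappa2 G = enat n\<close> entails that a minimum exists and equals \<open>n\<close>.
\<close>

definition kappa2 :: "('a, 'b) pre_digraph \<Rightarrow> enat" where
  "kappa2 G = (INF S \<in> {S. disconnecting_set G S \<and>
                 (\<forall>C \<in> pre_digraph.sccs (G \<restriction> (verts G - S)). 2 \<le> card (verts C))}.
               enat (card S))"

end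

theory Submission
  imports Defs
begin

text \<open>
  A disconnected \<open>G \<setminus> S\<close> splits into two unions of components \<open>X\<close>, \<open>Y\<close>, which are orthogonal
  sets of vectors on which the form \<open>Q\<close> is \<open>1\<close>, each containing an edge. With \<open>q = 2\<^bsup>r-2\<^esup>\<close> the claim is
  \<open>|X| + |Y| \<le> 2q\<^sup>2 - q + 3\<close>, with equality for a line \<open>{x, y, x + y}\<close> and its orthogonal set.
  If \<open>X\<close> or \<open>Y\<close> lies in such a line, the bound is a character count. Otherwise each of \<open>X\<close>, \<open>Y\<close>
  is orthogonal to three independent vertices, so \<open>|X|, |Y| \<le> q\<^sup>2\<close>, which settles \<open>q = 2\<close>; for
  \<open>q \<ge> 4\<close> one also has \<open>|X||Y| < 16q\<^sup>2\<close> because the character table \<open>(-1)\<^bsup>B(x,y)\<^esup>\<close> is a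
  Hadamard matrix of order \<open>16q\<^sup>2\<close>, and \<open>(q\<^sup>2 - |X|)(q\<^sup>2 - |Y|) \<ge> 0\<close> then gives
  \<open>|X| + |Y| < q\<^sup>2 + 16\<close>.
\<close>

section \<open>Disconnecting sets as separations\<close>

lemma arcs_ends_induce_subgraph:
  "arcs_ends (G \<restriction> W) = {(u, v) \<in> arcs_ends G. u \<in> W \<and> v \<in> W}"
  by (auto simp: arcs_ends_conv)

lemma (in sym_digraph) sym_digraph_induce_subgraph:
  "W \<subseteq> verts G \<Longrightarrow> sym_digraph (G \<restriction> W)"
  by (rule induced_graph_imp_graph[OF induced_induce])

lemma (in sym_digraph) connected_iff_strongly_connected:
  "connected G \<longleftrightarrow> strongly_connected G"
  using symmetric_connected_imp_strongly_connected[OF sym_arcs]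
  by (auto simp: connected_def strongly_connected_def reachable_mk_symmetric_eq[OF sym_arcs])

text \<open>A walk from \<open>v\<close> to a second vertex of its component has a first arc. This
  is all that the lower bound retains of the condition on component sizes.\<close>

lemma (in sym_digraph) neighbour_of_large_scc:
  assumes "\<forall>C \<in> sccs. 2 \<le> card (verts C)" "v \<in> verts G"
  obtains w where "v \<rightarrow>\<^bsub>G\<^esub> w"
proof -
  have "scc_of v \<in> verts ` sccs"
    using scc_of_in_sccs_verts[OF assms(2)] by (simp add: sccs_verts_conv)
  then have "2 \<le> card (scc_of v)"
    using assms(1) by auto
  then have "\<not> scc_of v \<subseteq> {v}"
    using card_mono[of "{v}" "scc_of v"] by auto
  then obtain u where u: "v \<rightarrow>\<^sup>* u" "u \<noteq> v"
    by (auto simp: scc_of_def)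
  from u(1) show ?thesis
    by (rule converse_reachable_cases) (use u(2) that in auto)
qed

text \<open>Since arcs are symmetric, a neighbour lies in the same component. The condition
  \<open>w \<noteq> v\<close> excludes loops, which \<open>sym_digraph\<close> permits.\<close>

lemma (in sym_digraph) two_le_card_scc:
  assumes "finite (verts G)" "\<And>v. v \<in> verts G \<Longrightarrow> \<exists>w. w \<noteq> v \<and> v \<rightarrow>\<^bsub>G\<^esub> w"
    and "C \<in> sccs"
  shows "2 \<le> card (verts C)"
proof -
  have "verts C \<in> sccs_verts"
    using assms(3) by (simp add: sccs_verts_conv)
  then obtain v where v: "v \<in> verts G" and C: "verts C = scc_of v"
    by (auto simp: sccs_verts_conv_scc_of)
  obtain w where w: "w \<noteq> v" "v \<rightarrow> w"
    using assms(2)[OF v] by blast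
  then have "v \<rightarrow>\<^sup>* w" by blast
  then have "{v, w} \<subseteq> verts C"
    using v in_scc_of_self[OF v] scc_ofI_reachable' by (auto simp: C)
  moreover have "finite (verts C)"
    using assms(1) finite_subset[of "verts C" "verts G"] reachable_in_verts
    by (auto simp: C scc_of_def)
  ultimately have "card {v, w} \<le> card (verts C)"
    by (intro card_mono)
  then show ?thesis using w(1) by simp
qed

definition admissible :: "('a, 'b) pre_digraph \<Rightarrow> 'a set \<Rightarrow> bool" where
  "admissible G S \<longleftrightarrow> disconnecting_set G S \<and>
     (\<forall>C \<in> pre_digraph.sccs (G \<restriction> (verts G - S)). 2 \<le> card (verts C))"

lemma kappa2_admissible: "kappa2 G = (INF S \<in> Collect (admissible G). enat (card S))"
  by (simp add: kappa2_def admissible_def[abs_def])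

text \<open>\<open>X\<close> is the component of a vertex \<open>u\<close> that fails to reach some
  \<open>v\<close>, and \<open>Y\<close> is everything else that remains. \<open>Y\<close> may
  consist of several components.\<close>

lemma (in sym_digraph) admissible_imp_separation:
  assumes "admissible G S"
  obtains X Y where "X \<union> Y = verts G - S" "X \<inter> Y = {}" "X \<noteq> {}" "Y \<noteq> {}"
    "\<forall>x\<in>X. \<forall>y\<in>Y. \<not> x \<rightarrow> y" "\<forall>v\<in>verts G - S. \<exists>w\<in>verts G - S. v \<rightarrow> w"
proof -
  define W where "W = verts G - S"
  interpret H: sym_digraph "G \<restriction> W"
    by (rule sym_digraph_induce_subgraph) (auto simp: W_def)
  have S: "W \<noteq> {}" "\<not> strongly_connected (G \<restriction> W)"
    "\<forall>C \<in> H.sccs. 2 \<le> card (verts C)"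
    using assms H.connected_iff_strongly_connected
    by (simp_all add: admissible_def disconnecting_set_def W_def)
  then obtain u v where uv: "u \<in> W" "v \<in> W" "\<not> u \<rightarrow>\<^sup>*\<^bsub>G \<restriction> W\<^esub> v"
    by (auto simp: strongly_connected_def)
  define X where "X = {w. u \<rightarrow>\<^sup>*\<^bsub>G \<restriction> W\<^esub> w}"
  have XW: "X \<subseteq> W"
    using H.reachable_in_verts by (auto simp: X_def)
  have u: "u \<in> X"
    using uv(1) by (simp add: X_def)
  show ?thesis
  proof (rule that[of X "W - X"])
    show "X \<union> (W - X) = verts G - S" using XW by (auto simp: W_def)
    show "X \<inter> (W - X) = {}" by blast
    show "X \<noteq> {}" using u by blast
    show "W - X \<noteq> {}" using uv by (auto simp: X_def)
    show "\<forall>x\<in>X. \<forall>y\<in>W - X. \<not> x \<rightarrow> y"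
    proof (intro ballI notI)
      fix x y assume that: "x \<in> X" "y \<in> W - X"
      assume "x \<rightarrow> y"
      then have "x \<rightarrow>\<^bsub>G \<restriction> W\<^esub> y"
        using that XW by (auto simp: arcs_ends_induce_subgraph)
      then show False
        using that H.reachable_adj_trans by (auto simp: X_def)
    qed
    show "\<forall>v\<in>verts G - S. \<exists>w\<in>verts G - S. v \<rightarrow> w"
    proof
      fix v assume v: "v \<in> verts G - S"
      obtain w where "v \<rightarrow>\<^bsub>G \<restriction> W\<^esub> w"
        using H.neighbour_of_large_scc[OF S(3), of v] v by (auto simp: W_def)
      then show "\<exists>w\<in>verts G - S. v \<rightarrow> w"
        by (auto simp: arcs_ends_induce_subgraph W_def)
    qed
  qed
qed

lemma (in sym_digraph) separation_imp_admissible: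
  assumes fin: "finite (verts G)"
    and XY: "X \<union> Y \<subseteq> verts G" "X \<inter> Y = {}" "X \<noteq> {}" "Y \<noteq> {}"
    and sep: "\<And>x y. x \<in> X \<Longrightarrow> y \<in> Y \<Longrightarrow> \<not> x \<rightarrow> y"
    and nb: "\<And>v. v \<in> X \<union> Y \<Longrightarrow> \<exists>w \<in> X \<union> Y. w \<noteq> v \<and> v \<rightarrow> w"
  shows "admissible G (verts G - (X \<union> Y))"
proof -
  define W where "W = X \<union> Y"
  have W: "verts G - (verts G - (X \<union> Y)) = W"
    using XY by (auto simp: W_def)
  interpret H: sym_digraph "G \<restriction> W"
    by (rule sym_digraph_induce_subgraph) (use XY in \<open>auto simp: W_def\<close>)
  have "\<not> strongly_connected (G \<restriction> W)"
  proof
    assume conn: "strongly_connected (G \<restriction> W)"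
    obtain x y where xy: "x \<in> X" "y \<in> Y" using XY by blast
    then have "x \<rightarrow>\<^sup>*\<^bsub>G \<restriction> W\<^esub> y"
      using conn by (auto simp: strongly_connected_def W_def)
    \<comment> \<open>No arc leads from \<open>X\<close> to \<open>Y\<close>, so a walk that starts
      in \<open>X\<close> stays there.\<close>
    then have "y \<in> X"
    proof (induction rule: H.reachable_induct)
      case base
      show ?case by (rule xy)
    next
      case (step a b)
      then show ?case
        using sep by (auto simp: arcs_ends_induce_subgraph W_def)
    qed
    then show False using xy XY by blast
  qed
  moreover have "2 \<le> card (verts C)" if "C \<in> H.sccs" for C
    by (rule H.two_le_card_scc[OF _ _ that])
      (use nb finite_subset[OF XY(1) fin] in
        \<open>auto simp: arcs_ends_induce_subgraph W_def\<close>)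
  ultimately show ?thesis
    using XY H.connected_iff_strongly_connected
    by (auto simp: admissible_def disconnecting_set_def W) (auto simp: W_def)
qed

section \<open>Quadratic forms over the two-element field\<close>

text \<open>Bits are treated as elements of a field, so sums and products must keep their ring
  notation.\<close>

declare add_bit_eq_xor [simp del] mult_bit_eq_and [simp del]

text \<open>The nontrivial additive character of the two-element field.\<close>

definition chi :: "bit \<Rightarrow> int" where
  "chi b = (if b = 0 then 1 else - 1)"

lemma chi_simps [simp]: "chi 0 = 1" "chi 1 = - 1"
  by (simp_all add: chi_def)

lemma chi_add: "chi (a + b) = chi a * chi b"
  by (cases a; cases b) simp_all

lemma chi_le_1: "chi b \<le> 1"
  by (cases b) simp_all

lemma chi_square [simp]: "chi b * chi b = 1"
  by (cases b) simp_all

text \<open>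
  The dimension is encoded by \<^term>\<open>16 * q\<^sup>2\<close> vectors, and the sign of the Gauss sum is what makes
  the form elliptic rather than hyperbolic.
\<close>

locale quadratic_space =
  fixes C :: "'v :: plus set" and zero :: 'v and Q :: "'v \<Rightarrow> bit" and B :: "'v \<Rightarrow> 'v \<Rightarrow> bit"
    and q :: nat
  assumes finite_C: "finite C"
    and zero_closed [simp]: "zero \<in> C"
    and add_closed [simp]: "x \<in> C \<Longrightarrow> y \<in> C \<Longrightarrow> x + y \<in> C"
    and add_assoc: "x \<in> C \<Longrightarrow> y \<in> C \<Longrightarrow> z \<in> C \<Longrightarrow> x + y + z = x + (y + z)"
    and add_comm: "x \<in> C \<Longrightarrow> y \<in> C \<Longrightarrow> x + y = y + x"
    and add_zero [simp]: "x \<in> C \<Longrightarrow> x + zero = x"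
    and add_self [simp]: "x \<in> C \<Longrightarrow> x + x = zero"
    and Q_add: "x \<in> C \<Longrightarrow> y \<in> C \<Longrightarrow> Q (x + y) = Q x + Q y + B x y"
    and B_sym: "x \<in> C \<Longrightarrow> y \<in> C \<Longrightarrow> B x y = B y x"
    and B_add: "x \<in> C \<Longrightarrow> y \<in> C \<Longrightarrow> z \<in> C \<Longrightarrow> B x (y + z) = B x y + B x z"
    and Q_zero [simp]: "Q zero = 0"
    and nondegenerate: "u \<in> C \<Longrightarrow> u \<noteq> zero \<Longrightarrow> \<exists>e\<in>C. B e u = 1"
    and card_C: "card C = 16 * q\<^sup>2"
    and gauss_sum: "(\<Sum>z\<in>C. chi (Q z)) = - 4 * int q"
begin

definition V :: "'v set" where
  "V = {x \<in> C. Q x = 1}"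

lemma V_D [simp]: "x \<in> V \<Longrightarrow> x \<in> C" "x \<in> V \<Longrightarrow> Q x = 1"
  by (simp_all add: V_def)

lemma V_subset [simp]: "V \<subseteq> C"
  by (auto simp: V_def simp del: V_D)

lemma finite_V: "finite V"
  by (simp add: V_def finite_C del: V_D)

lemma B_self [simp]: "x \<in> C \<Longrightarrow> B x x = 0"
  using Q_add[of x x] by (cases "Q x"; cases "B x x") simp_all

lemma B_zero [simp]: "x \<in> C \<Longrightarrow> B x zero = 0"
  using B_add[of x x x] by (cases "B x x") simp_all

lemma add_add_cancel [simp]: "x \<in> C \<Longrightarrow> y \<in> C \<Longrightarrow> x + y + y = x"
  by (simp add: add_assoc)

lemma add_eq_zero_iff: "x \<in> C \<Longrightarrow> y \<in> C \<Longrightarrow> x + y = zero \<longleftrightarrow> x = y"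
  using add_add_cancel[of x y] add_comm[of zero y] by auto

section \<open>Character sums over the space and over the quadric\<close>

lemma sum_translate:
  fixes f :: "'v \<Rightarrow> int"
  assumes "u \<in> C"
  shows "(\<Sum>z\<in>C. f (z + u)) = (\<Sum>z\<in>C. f z)"
  by (rule sum.reindex_bij_witness[where i = "\<lambda>z. z + u" and j = "\<lambda>z. z + u"])
    (use assms in auto)

text \<open>For \<open>u \<noteq> zero\<close>, translation by some \<open>e\<close> with
  \<open>B e u = 1\<close> flips every sign, so the sum equals its own negative.\<close>

lemma character_sum:
  assumes u: "u \<in> C"
  shows "(\<Sum>z\<in>C. chi (B z u)) = (if u = zero then 16 * (int q)\<^sup>2 else 0)"
proof (cases "u = zero")
  case True
  then show ?thesis by (simp add: card_C)
next
  case False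
  then obtain e where e: "e \<in> C" "B e u = 1"
    using nondegenerate u by blast
  have "(\<Sum>z\<in>C. chi (B z u)) = (\<Sum>z\<in>C. chi (B (z + e) u))"
    using sum_translate[OF e(1), of "\<lambda>z. chi (B z u)"] by simp
  also have "\<dots> = (\<Sum>z\<in>C. - chi (B z u))"
    by (rule sum.cong) (use e u in \<open>auto simp: B_sym[of _ u] B_add chi_add\<close>)
  finally show ?thesis
    using False by (simp add: sum_negf)
qed

text \<open>Completing the square: \<open>Q z + B z u = Q (z + u) + Q u\<close>, and a translation
  removes the shift.\<close>

lemma twisted_gauss_sum:
  assumes u: "u \<in> C"
  shows "(\<Sum>z\<in>C. chi (Q z) * chi (B z u)) = - 4 * int q * chi (Q u)"
proof -
  have "(\<Sum>z\<in>C. chi (Q z) * chi (B z u)) = (\<Sum>z\<in>C. chi (Q (z + u)) * chi (Q u))"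
    by (rule sum.cong) (use u in \<open>auto simp: Q_add chi_add\<close>)
  also have "\<dots> = (\<Sum>z\<in>C. chi (Q z)) * chi (Q u)"
    using sum_translate[OF u, of "\<lambda>z. chi (Q z)"] by (simp flip: sum_distrib_right)
  finally show ?thesis by (simp add: gauss_sum)
qed

text \<open>The Fourier transform of the indicator of \<open>D\<close>; its value at
  \<open>zero\<close> counts \<open>D\<close>.\<close>

definition charsum :: "'v set \<Rightarrow> 'v \<Rightarrow> int" where
  "charsum D u = (\<Sum>z\<in>D. chi (B z u))"

lemma charsum_zero: "D \<subseteq> C \<Longrightarrow> charsum D zero = int (card D)"
proof -
  assume "D \<subseteq> C"
  then have "charsum D zero = (\<Sum>z\<in>D. 1)"
    unfolding charsum_def by (intro sum.cong) auto
  then show ?thesis by simp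
qed

text \<open>The indicator of \<open>Q z = 1\<close> is \<open>(1 - chi (Q z)) / 2\<close>. The
  factor 2 stays on the left so that all values are integers.\<close>

lemma charsum_V:
  assumes u: "u \<in> C"
  shows "2 * charsum V u = (if u = zero then 16 * (int q)\<^sup>2 else 0) + 4 * int q * chi (Q u)"
proof -
  have "2 * charsum V u = (\<Sum>z\<in>C. if Q z = 1 then 2 * chi (B z u) else 0)"
    unfolding charsum_def V_def sum_distrib_left by (rule sum.inter_filter[OF finite_C])
  also have "\<dots> = (\<Sum>z\<in>C. chi (B z u) - chi (Q z) * chi (B z u))"
    by (rule sum.cong) (auto simp: chi_def)
  finally show ?thesis
    using u by (simp add: sum_subtractf character_sum twisted_gauss_sum)
qed

lemma charsum_V_in_V:
  assumes "u \<in> V"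
  shows "2 * charsum V u = - 4 * int q"
proof -
  have "u \<noteq> zero" using assms by (auto simp: V_def simp del: V_D)
  then show ?thesis using charsum_V[of u] assms by simp
qed

text \<open>The indicator of \<open>B z x = 0\<close> is \<open>(1 + chi (B z x)) / 2\<close>, and
  the characters at \<open>u\<close> and \<open>x\<close> multiply to the one at
  \<open>u + x\<close>. Repeated use handles several orthogonality conditions.\<close>

lemma charsum_orthogonal:
  assumes "D \<subseteq> C" "x \<in> C" "u \<in> C"
  shows "2 * charsum {z \<in> D. B z x = 0} u = charsum D u + charsum D (u + x)"
proof -
  have fin: "finite D" using assms(1) finite_C finite_subset by blast
  have "2 * charsum {z \<in> D. B z x = 0} u = (\<Sum>z\<in>D. if B z x = 0 then 2 * chi (B z u) else 0)"
    unfolding charsum_def sum_distrib_left by (rule sum.inter_filter[OF fin])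
  also have "\<dots> = (\<Sum>z\<in>D. chi (B z u) + chi (B z (u + x)))"
  proof (rule sum.cong)
    fix z assume "z \<in> D"
    then have "z \<in> C" using assms by blast
    then show "(if B z x = 0 then 2 * chi (B z u) else 0) = chi (B z u) + chi (B z (u + x))"
      using assms by (auto simp: B_add chi_add chi_def)
  qed simp
  finally show ?thesis by (simp add: charsum_def sum.distrib)
qed

section \<open>Counting the vertices orthogonal to one, two or three given vertices\<close>

lemma zero_notin_V: "zero \<notin> V"
  by (simp add: V_def del: V_D)

lemma zero_add [simp]: "x \<in> C \<Longrightarrow> zero + x = x"
  using add_comm[of zero x] by simp

lemma card_V: "card V = 8 * q\<^sup>2 + 2 * q"
proof -
  have "2 * int (card V) = 16 * (int q)\<^sup>2 + 4 * int q"
    using charsum_V[OF zero_closed] charsum_zero[OF V_subset] by simp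
  then have "int (card V) = 8 * (int q)\<^sup>2 + 2 * int q" by linarith
  also have "\<dots> = int (8 * q\<^sup>2 + 2 * q)" by simp
  finally show ?thesis by (simp only: of_nat_eq_iff)
qed

lemma card_orthogonal1:
  assumes x: "x \<in> V"
  shows "card {z \<in> V. B z x = 0} = 4 * q\<^sup>2"
proof -
  let ?D = "{z \<in> V. B z x = 0}"
  have "2 * charsum ?D zero = charsum V zero + charsum V x"
    using charsum_orthogonal[OF V_subset, of x zero] x by simp
  moreover have "charsum ?D zero = int (card ?D)"
    by (rule charsum_zero) auto
  moreover have "2 * charsum V zero = 16 * (int q)\<^sup>2 + 4 * int q"
    using charsum_V[OF zero_closed] by simp
  ultimately have "int (card ?D) = 4 * (int q)\<^sup>2"
    using charsum_V_in_V[OF x] by linarith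
  also have "\<dots> = int (4 * q\<^sup>2)" by simp
  finally show ?thesis by (simp only: of_nat_eq_iff)
qed

text \<open>Here \<open>1 + 1 + 1 = 1\<close>: each edge completes to a line
  \<open>{x, y, x + y}\<close> of vertices.\<close>

lemma add_in_V: "x \<in> V \<Longrightarrow> y \<in> V \<Longrightarrow> B x y = 1 \<Longrightarrow> x + y \<in> V"
  by (simp add: V_def Q_add del: V_D)

definition orth2 :: "'v \<Rightarrow> 'v \<Rightarrow> 'v set" where
  "orth2 x y = {z \<in> V. B z x = 0 \<and> B z y = 0}"

lemma charsum_orth2:
  assumes "x \<in> C" "y \<in> C" "u \<in> C"
  shows "4 * charsum (orth2 x y) u =
    charsum V u + charsum V (u + x) + charsum V (u + y) + charsum V (u + y + x)"
proof -
  have "orth2 x y = {z \<in> {z \<in> V. B z x = 0}. B z y = 0}"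
    by (auto simp: orth2_def)
  moreover have "{z \<in> V. B z x = 0} \<subseteq> C" by auto
  ultimately have "2 * charsum (orth2 x y) u =
      charsum {z \<in> V. B z x = 0} u + charsum {z \<in> V. B z x = 0} (u + y)"
    using charsum_orthogonal[of "{z \<in> V. B z x = 0}" y u] assms by simp
  then show ?thesis
    using charsum_orthogonal[OF V_subset, of x u] charsum_orthogonal[OF V_subset, of x "u + y"]
      assms by simp
qed

text \<open>The character at \<open>zero\<close> contributes \<open>8 * q\<^sup>2 + 2 * q\<close>
  and each point of the line \<open>- 2 * q\<close>; a quarter of the total is
  \<open>2 * q\<^sup>2 - q\<close>. Adding \<open>q\<close> on the left avoids truncated
  subtraction.\<close>

lemma card_orth2:
  assumes x: "x \<in> V" and y: "y \<in> V" and xy: "B x y = 1"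
  shows "card (orth2 x y) + q = 2 * q\<^sup>2"
proof -
  have yx: "y + x \<in> V"
    using add_in_V[of y x] x y xy B_sym[of x y] by simp
  have "4 * charsum (orth2 x y) zero =
      charsum V zero + charsum V x + charsum V y + charsum V (y + x)"
    using charsum_orth2[of x y zero] x y by simp
  moreover have "charsum (orth2 x y) zero = int (card (orth2 x y))"
    by (rule charsum_zero) (auto simp: orth2_def)
  moreover have "2 * charsum V zero = 16 * (int q)\<^sup>2 + 4 * int q"
    using charsum_V[OF zero_closed] by simp
  ultimately have "int (card (orth2 x y)) + int q = 2 * (int q)\<^sup>2"
    using charsum_V_in_V[OF x] charsum_V_in_V[OF y] charsum_V_in_V[OF yx] by linarith
  then have "int (card (orth2 x y) + q) = int (2 * q\<^sup>2)" by simp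
  then show ?thesis by (simp only: of_nat_eq_iff)
qed

text \<open>Eight characters enter, one for each vector spanned by \<open>x\<close>,
  \<open>y\<close>, \<open>a\<close>. The vertices \<open>x\<close>, \<open>y\<close>,
  \<open>x + y\<close>, \<open>a\<close> contribute \<open>- 2 * q\<close> each, and the other three
  nonzero vectors at most \<open>2 * q\<close> each, so the total is at most
  \<open>8 * q\<^sup>2\<close>.\<close>

lemma card_orth3_le:
  assumes x: "x \<in> V" and y: "y \<in> V" and xy: "B x y = 1"
    and a: "a \<in> V" "a \<notin> {x, y, x + y}"
  shows "card {z \<in> orth2 x y. B z a = 0} \<le> q\<^sup>2"
proof -
  let ?D = "{z \<in> orth2 x y. B z a = 0}"
  have sub: "orth2 x y \<subseteq> C" by (auto simp: orth2_def)
  have yx: "y + x \<in> V"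
    using add_in_V[of y x] x y xy B_sym[of x y] by simp
  have nz: "a + x \<noteq> zero" "a + y \<noteq> zero" "a + y + x \<noteq> zero"
    using a x y yx add_comm[of x y]
    by (simp_all add: add_eq_zero_iff add_assoc)
  have "2 * charsum ?D zero = charsum (orth2 x y) zero + charsum (orth2 x y) a"
    using charsum_orthogonal[OF sub, of a zero] a by simp
  then have "8 * charsum ?D zero =
      charsum V zero + charsum V x + charsum V y + charsum V (y + x) +
      charsum V a + charsum V (a + x) + charsum V (a + y) + charsum V (a + y + x)"
    using charsum_orth2[of x y zero] charsum_orth2[of x y a] x y a by simp
  moreover have "2 * charsum V u \<le> 4 * int q" if "u \<in> C" "u \<noteq> zero" for u
    using charsum_V[OF that(1)] that mult_left_mono[OF chi_le_1[of "Q u"], of "4 * int q"]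
    by simp
  then have "2 * charsum V (a + x) \<le> 4 * int q" "2 * charsum V (a + y) \<le> 4 * int q"
    "2 * charsum V (a + y + x) \<le> 4 * int q"
    using nz x y a by simp_all
  moreover have "2 * charsum V zero = 16 * (int q)\<^sup>2 + 4 * int q"
    using charsum_V[OF zero_closed] by simp
  moreover have "charsum ?D zero = int (card ?D)"
    by (rule charsum_zero) (use sub in blast)
  ultimately have "int (card ?D) \<le> (int q)\<^sup>2"
    using charsum_V_in_V[OF x] charsum_V_in_V[OF y] charsum_V_in_V[OF yx] charsum_V_in_V[OF a(1)]
    by linarith
  also have "\<dots> = int (q\<^sup>2)" by simp
  finally show ?thesis by (simp only: of_nat_le_iff)
qed

text \<open>
  The matrix \<open>(\<chi>(B x y))\<close> is a Hadamard matrix, and two orthogonal sets span an all-ones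
  submatrix of it; this is Lindsey's lemma.
\<close>

lemma card_orthogonal_product:
  assumes X: "X \<subseteq> C" and Y: "Y \<subseteq> C" and orth: "\<And>x y. x \<in> X \<Longrightarrow> y \<in> Y \<Longrightarrow> B x y = 0"
  shows "card X * card Y \<le> 16 * q\<^sup>2"
proof (cases "card Y = 0")
  case False
  have fin: "finite X" "finite Y"
    using X Y finite_C finite_subset by blast+
  \<comment> \<open>Restricted to the columns \<open>Y\<close>, every row in \<open>X\<close> sums
    to \<open>card Y\<close>. The squared row sums over all of \<open>C\<close> total
    \<open>16 * q\<^sup>2 * card Y\<close>, because distinct columns are orthogonal.\<close>
  have "int (card X) * (int (card Y))\<^sup>2 = (\<Sum>z\<in>X. (\<Sum>y\<in>Y. chi (B z y))\<^sup>2)"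
    using orth by simp
  also have "\<dots> \<le> (\<Sum>z\<in>C. (\<Sum>y\<in>Y. chi (B z y))\<^sup>2)"
    by (rule sum_mono2) (use finite_C X in auto)
  also have "\<dots> = (\<Sum>z\<in>C. \<Sum>y\<in>Y. \<Sum>y'\<in>Y. chi (B z (y + y')))"
  proof (rule sum.cong)
    fix z assume z: "z \<in> C"
    have "(\<Sum>y\<in>Y. chi (B z y))\<^sup>2 = (\<Sum>y\<in>Y. \<Sum>y'\<in>Y. chi (B z y) * chi (B z y'))"
      by (simp add: power2_eq_square sum_product)
    also have "\<dots> = (\<Sum>y\<in>Y. \<Sum>y'\<in>Y. chi (B z (y + y')))"
      by (intro sum.cong refl) (use Y z in \<open>auto simp: B_add chi_add subset_iff\<close>)
    finally show "(\<Sum>y\<in>Y. chi (B z y))\<^sup>2 = (\<Sum>y\<in>Y. \<Sum>y'\<in>Y. chi (B z (y + y')))" .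
  qed simp
  also have "\<dots> = (\<Sum>y\<in>Y. \<Sum>y'\<in>Y. \<Sum>z\<in>C. chi (B z (y + y')))"
    by (subst sum.swap, rule sum.cong, simp, rule sum.swap)
  also have "\<dots> = (\<Sum>y\<in>Y. \<Sum>y'\<in>Y. if y = y' then 16 * (int q)\<^sup>2 else 0)"
    by (intro sum.cong refl) (use Y in \<open>auto simp: character_sum add_eq_zero_iff subset_iff\<close>)
  also have "\<dots> = 16 * (int q)\<^sup>2 * int (card Y)"
    using fin by (simp add: sum.delta)
  finally have "int (card X * card Y) * int (card Y) \<le> int (16 * q\<^sup>2) * int (card Y)"
    by (simp add: power2_eq_square algebra_simps)
  then show ?thesis
    using False by (metis mult_le_cancel2 of_nat_le_iff of_nat_mult neq0_conv)
qed simp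

text \<open>The edge in each set confines the other set to the orthogonal set of a line. Powers of
  two from 2 on satisfy the condition on \<open>q\<close>.\<close>

lemma card_orthogonal_sum_le:
  assumes q: "q = 2 \<or> q \<ge> 4"
    and X: "X \<subseteq> V" "x \<in> X" "x' \<in> X" "B x x' = 1"
    and Y: "Y \<subseteq> V" "y \<in> Y" "y' \<in> Y" "B y y' = 1"
    and orth: "\<And>x y. x \<in> X \<Longrightarrow> y \<in> Y \<Longrightarrow> B x y = 0"
  shows "card X + card Y + q \<le> 2 * q\<^sup>2 + 3"
proof -
  have inV: "x \<in> V" "x' \<in> V" "y \<in> V" "y' \<in> V" using X Y by auto
  have XV: "u \<in> V" if "u \<in> X" for u using that X(1) by blast
  have YV: "u \<in> V" if "u \<in> Y" for u using that Y(1) by blast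
  have orth': "B y x = 0" if "x \<in> X" "y \<in> Y" for x y
    using orth[OF that] B_sym[of x y] XV[OF that(1)] YV[OF that(2)] by simp
  have fin: "finite (orth2 u v)" for u v
    using finite_V by (simp add: orth2_def)
  have Xo: "X \<subseteq> orth2 y y'" and Yo: "Y \<subseteq> orth2 x x'"
    using X(2,3) Y(2,3) XV YV orth orth' unfolding orth2_def by blast+
  have three: "card {u, v, u + v} \<le> 3" for u v :: 'v
    by (simp add: card_insert_if)
  \<comment> \<open>Stated for arbitrary \<open>X'\<close> and \<open>Y'\<close> because it is
    applied with the two sides in either order.\<close>
  have line: "card X' + card Y' + q \<le> 2 * q\<^sup>2 + 3"
    if "X' \<subseteq> {u, v, u + v}" "Y' \<subseteq> orth2 u v" "u \<in> V" "v \<in> V" "B u v = 1" for X' Y' u v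
  proof -
    have "card X' \<le> 3"
      using card_mono[OF _ that(1)] three[of u v] by simp
    moreover have "card Y' \<le> card (orth2 u v)"
      by (rule card_mono[OF fin that(2)])
    ultimately show ?thesis using card_orth2[OF that(3-5)] by linarith
  qed
  \<comment> \<open>In the third case \<open>a\<close> and \<open>b\<close> lie off the lines of the
    chosen edges, so \<open>card_orth3_le\<close> bounds both sides.\<close>
  consider "X \<subseteq> {x, x', x + x'}" | "Y \<subseteq> {y, y', y + y'}"
    | a b where "a \<in> X" "a \<notin> {x, x', x + x'}" "b \<in> Y" "b \<notin> {y, y', y + y'}"
    by blast
  then show ?thesis
  proof cases
    case 1
    then show ?thesis using line[OF 1 Yo inV(1,2) X(4)] by simp
  next
    case 2
    then show ?thesis using line[OF 2 Xo inV(3,4) Y(4)] by simp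
  next
    case 3
    have "Y \<subseteq> {z \<in> orth2 x x'. B z a = 0}" "X \<subseteq> {z \<in> orth2 y y'. B z b = 0}"
      using Xo Yo orth orth' 3 by blast+
    then have "card Y \<le> card {z \<in> orth2 x x'. B z a = 0}"
      "card X \<le> card {z \<in> orth2 y y'. B z b = 0}"
      using fin by (auto intro!: card_mono)
    moreover have "a \<in> V" "b \<in> V" using 3 XV YV by blast+
    ultimately have le: "card Y \<le> q\<^sup>2" "card X \<le> q\<^sup>2"
      using card_orth3_le[of x x' a] card_orth3_le[of y y' b] inV X Y 3 by auto
    show ?thesis
    proof (cases "q = 2")
      case True
      then show ?thesis using le by simp
    next
      case False
      then have q4: "q \<ge> 4" using q by simp
      have finXY: "finite X" "finite Y" using X Y finite_V finite_subset by blast+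
      \<comment> \<open>The zero vector is orthogonal to everything but is not a vertex. Adjoining
        it to \<open>X\<close> makes the product bound for \<open>X\<close> and \<open>Y\<close>
        strict.\<close>
      have "card (insert zero X) * card Y \<le> 16 * q\<^sup>2"
        by (rule card_orthogonal_product) (use XV YV orth B_sym[of zero] in auto)
      moreover have "zero \<notin> X" using X zero_notin_V by blast
      moreover have "card Y > 0" using Y finXY by (auto simp: card_gt_0_iff)
      ultimately have "card X * card Y < 16 * q\<^sup>2"
        using finXY by simp
      then have "int (card X * card Y) < int (16 * q\<^sup>2)"
        by (simp only: of_nat_less_iff)
      then have prod: "int (card X) * int (card Y) < 16 * int (q\<^sup>2)"
        by simp
      have "0 \<le> (int (q\<^sup>2) - int (card X)) * (int (q\<^sup>2) - int (card Y))"
        using le by (intro mult_nonneg_nonneg) simp_all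
      then have "int (q\<^sup>2) * (int (card X) + int (card Y)) < int (q\<^sup>2) * (int (q\<^sup>2) + 16)"
        using prod by (simp add: algebra_simps)
      then have "int (card X) + int (card Y) < int (q\<^sup>2) + 16"
        using q4 by (simp add: mult_less_cancel_left)
      then have "int (card X + card Y) < int (q\<^sup>2 + 16)"
        by simp
      then have "card X + card Y < q\<^sup>2 + 16"
        by (simp only: of_nat_less_iff)
      \<comment> \<open>What remains is \<open>q + 12 \<le> q\<^sup>2\<close>. It is an equality at
        \<open>q = 4\<close>, where the strictness of the product bound is therefore used in
        full.\<close>
      moreover have "4 * q \<le> q\<^sup>2" using q4 by (simp add: power2_eq_square)
      ultimately show ?thesis using q4 by linarith
    qed
  qed
qed

section \<open>The extremal separation and the value of \<open>kappa2\<close>\<close>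

lemma exists_adjacent:
  assumes "q > 0"
  obtains x y where "x \<in> V" "y \<in> V" "B x y = 1"
proof -
  have "card V > 0" using card_V assms by simp
  then obtain x where x: "x \<in> V" by (metis card.empty ex_in_conv less_irrefl)
  have "{z \<in> V. B z x = 0} \<noteq> V"
    using card_orthogonal1[OF x] card_V assms by auto
  then obtain y where "y \<in> V" "B y x \<noteq> 0" by blast
  then show ?thesis using that x by auto
qed

text \<open>Ensures that no vertex of the large side is isolated. A vertex orthogonal to
  \<open>x\<close> and \<open>y\<close> is off their line, so it is orthogonal to at most
  \<open>q\<^sup>2\<close> of the \<open>2 * q\<^sup>2 - q\<close> vertices of
  \<open>orth2 x y\<close>.\<close>

lemma exists_adjacent_in_orth2:
  assumes q: "q \<ge> 2" and "x \<in> V" "y \<in> V" "B x y = 1" "a \<in> orth2 x y"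
  obtains z where "z \<in> orth2 x y" "B a z = 1"
proof -
  have a: "a \<in> V" "B a x = 0" "B a y = 0" using assms by (auto simp: orth2_def)
  have yx: "B y x = 1" using assms B_sym[of x y] by simp
  then have "B (x + y) y = 1"
    using assms B_sym[of "x + y" y] B_add[of y x y] by simp
  then have "a \<notin> {x, y, x + y}"
    using a assms(4) yx by auto
  then have "card {z \<in> orth2 x y. B z a = 0} \<le> q\<^sup>2"
    using card_orth3_le a assms by blast
  moreover have "card (orth2 x y) > q\<^sup>2"
  proof -
    have "2 * q \<le> q\<^sup>2" using q by (simp add: power2_eq_square)
    then show ?thesis
      using card_orth2[OF assms(2-4)] q by linarith
  qed
  ultimately have "{z \<in> orth2 x y. B z a = 0} \<noteq> orth2 x y" by auto
  then obtain z where "z \<in> orth2 x y" "B z a \<noteq> 0" by blast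
  then show ?thesis using that a B_sym[of z a] by (auto simp: orth2_def)
qed

text \<open>The value is \<open>card V\<close> minus the largest possible size
  \<open>2 * q\<^sup>2 - q + 3\<close> of a separated pair.\<close>

lemma kappa2_eq:
  assumes q: "q = 2 \<or> q \<ge> 4" and "sym_digraph G" and verts: "verts G = V"
    and arcs: "arcs_ends G = {(x, y). x \<in> V \<and> y \<in> V \<and> B x y = 1}"
  shows "kappa2 G = enat (6 * q\<^sup>2 + 3 * q - 3)"
proof -
  interpret sym_digraph G by fact
  show ?thesis
    unfolding kappa2_admissible
  proof (rule antisym)
    have "q > 0" using q by auto
    then obtain x y where xy: "x \<in> V" "y \<in> V" "B x y = 1"
      using exists_adjacent by blast
    have yx: "B y x = 1"
      using xy B_sym[of x y] by simp
    have sum: "x + y \<in> V"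
      using xy by (rule add_in_V)
    have Bsum: "B z (x + y) = B z x + B z y" if "z \<in> V" for z
      using xy that B_add by simp
    have B': "B (x + y) x = 1" "B (x + y) y = 1"
      using xy yx Bsum sum B_sym[of "x + y" x] B_sym[of "x + y" y] by simp_all
    \<comment> \<open>Upper bound: a line and its orthogonal set attain the extremal size.\<close>
    define X where "X = {x, y, x + y}"
    define Y where "Y = orth2 x y"
    have disj: "X \<inter> Y = {}"
      using xy yx B' by (auto simp: X_def Y_def orth2_def)
    have "x \<noteq> y" "x \<noteq> x + y" "y \<noteq> x + y"
      using xy B' by auto
    then have cardX: "card X = 3"
      by (simp add: X_def)
    have sub: "X \<union> Y \<subseteq> V"
      using xy sum by (auto simp: X_def Y_def orth2_def)
    have fin: "finite X" "finite Y"
      using sub finite_V finite_subset by blast+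
    have nonempty: "Y \<noteq> {}"
    proof
      assume "Y = {}"
      then have "q = 2 * q\<^sup>2"
        using card_orth2[OF xy] by (simp add: Y_def)
      then show False using q by (auto simp: power2_eq_square)
    qed
    have "admissible G (verts G - (X \<union> Y))"
    proof (rule separation_imp_admissible)
      show "\<not> a \<rightarrow>\<^bsub>G\<^esub> b" if "a \<in> X" "b \<in> Y" for a b
        using that xy sum Bsum[of b] B_sym[of _ b]
        by (auto simp: X_def Y_def orth2_def arcs)
      show "\<exists>w\<in>X \<union> Y. w \<noteq> v \<and> v \<rightarrow>\<^bsub>G\<^esub> w" if v: "v \<in> X \<union> Y" for v
      proof (cases "v \<in> Y")
        case True
        have q2: "q \<ge> 2" using q by auto
        obtain z where z: "z \<in> Y" "B v z = 1"
          using exists_adjacent_in_orth2[OF q2 xy] True unfolding Y_def by blast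
        then have "z \<noteq> v" using sub by auto
        then show ?thesis using z True sub by (auto simp: arcs)
      next
        case False
        then consider "v = x" | "v = y" | "v = x + y"
          using v by (auto simp: X_def)
        then show ?thesis
        proof cases
          case 1
          then show ?thesis using xy \<open>x \<noteq> y\<close> by (intro bexI[of _ y]) (auto simp: arcs X_def)
        next
          case 2
          then show ?thesis using xy yx \<open>x \<noteq> y\<close> by (intro bexI[of _ x]) (auto simp: arcs X_def)
        next
          case 3
          then show ?thesis using xy sum B' \<open>x \<noteq> x + y\<close>
            by (intro bexI[of _ x]) (auto simp: arcs X_def)
        qed
      qed
    qed (use sub disj cardX nonempty finite_V verts in auto)
    moreover have "card (verts G - (X \<union> Y)) = 6 * q\<^sup>2 + 3 * q - 3"
    proof -
      have "card (verts G - (X \<union> Y)) = card V - (card X + card Y)"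
        using sub fin disj verts by (simp add: card_Diff_subset card_Un_disjoint)
      then show ?thesis
        using card_V card_orth2[OF xy] cardX by (simp add: Y_def)
    qed
    ultimately show "(INF S\<in>Collect (admissible G). enat (card S)) \<le> enat (6 * q\<^sup>2 + 3 * q - 3)"
      by (metis (mono_tags, lifting) INF_lower mem_Collect_eq)
  next
    show "enat (6 * q\<^sup>2 + 3 * q - 3) \<le> (INF S\<in>Collect (admissible G). enat (card S))"
    proof (rule INF_greatest)
      fix S assume "S \<in> Collect (admissible G)"
      then have adm: "admissible G S" by simp
      then have SV: "S \<subseteq> V"
        by (simp add: admissible_def disconnecting_set_def verts)
      obtain X Y where XY: "X \<union> Y = verts G - S" "X \<inter> Y = {}" "X \<noteq> {}" "Y \<noteq> {}"
        and sep: "\<forall>x\<in>X. \<forall>y\<in>Y. \<not> x \<rightarrow>\<^bsub>G\<^esub> y"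
        and nb: "\<forall>v\<in>verts G - S. \<exists>w\<in>verts G - S. v \<rightarrow>\<^bsub>G\<^esub> w"
        by (rule admissible_imp_separation[OF adm])
      have sub: "X \<subseteq> V" "Y \<subseteq> V" using XY verts by auto
      have orth: "B x y = 0" if "x \<in> X" "y \<in> Y" for x y
        using sep that sub by (auto simp: arcs)
      have orth': "B y x = 0" if "x \<in> X" "y \<in> Y" for x y
        using orth[OF that] B_sym[of x y] sub[THEN subsetD] that by simp
      \<comment> \<open>A remaining neighbour of \<open>v\<close> cannot lie on the other side, so
        each side contains an edge.\<close>
      have nbX: "\<exists>w\<in>X. B v w = 1" if "v \<in> X" for v
      proof -
        have "v \<in> verts G - S" using that XY(1) by blast
        then obtain w where "w \<in> verts G - S" "v \<rightarrow>\<^bsub>G\<^esub> w"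
          using nb by blast
        then have "w \<in> X \<union> Y" "B v w = 1"
          using XY(1) arcs by simp_all
        then show ?thesis using orth[of v w] that by auto
      qed
      have nbY: "\<exists>w\<in>Y. B v w = 1" if "v \<in> Y" for v
      proof -
        have "v \<in> verts G - S" using that XY(1) by blast
        then obtain w where "w \<in> verts G - S" "v \<rightarrow>\<^bsub>G\<^esub> w"
          using nb by blast
        then have "w \<in> X \<union> Y" "B v w = 1"
          using XY(1) arcs by simp_all
        then show ?thesis using orth'[of w v] that by auto
      qed
      obtain x x' y y' where "x \<in> X" "x' \<in> X" "B x x' = 1" "y \<in> Y" "y' \<in> Y" "B y y' = 1"
        using nbX nbY XY(3,4) by blast
      then have le: "card X + card Y + q \<le> 2 * q\<^sup>2 + 3"
        using card_orthogonal_sum_le[OF q sub(1) _ _ _ sub(2) _ _ _ orth] by blast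
      have "finite X" "finite Y" "finite S"
        using sub SV finite_V finite_subset by blast+
      then have "card X + card Y = card V - card S"
        using card_Un_disjoint[of X Y] XY card_Diff_subset[of S V] SV verts by simp
      moreover have "card S \<le> card V"
        by (rule card_mono[OF finite_V SV])
      ultimately show "enat (6 * q\<^sup>2 + 3 * q - 3) \<le> enat (card S)"
        using le card_V by simp
    qed
  qed
qed

end

section \<open>The elliptic form in coordinates\<close>

lemma sum_pairs: "(\<Sum>i<2 * r. f i) = (\<Sum>i<r. f (2 * i) + f (2 * i + 1 :: nat))"
  for f :: "nat \<Rightarrow> 'a :: comm_monoid_add"
  by (induction r) (simp_all add: add.assoc)

lemma carrier_vec_bit_0: "carrier_vec 0 = {0\<^sub>v 0 :: bit vec}"
  by (rule Set.set_eqI) (simp only: carrier_vec_def mem_Collect_eq vec_of_dim_0 singleton_iff)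

lemma carrier_vec_bit_Suc:
  "carrier_vec (Suc n) = vCons 0 ` carrier_vec n \<union> vCons (1 :: bit) ` carrier_vec n"
proof (rule Set.set_eqI)
  fix x :: "bit vec"
  show "x \<in> carrier_vec (Suc n) \<longleftrightarrow> x \<in> vCons 0 ` carrier_vec n \<union> vCons 1 ` carrier_vec n"
  proof (cases x)
    case (vCons a w)
    then show ?thesis by (cases a) auto
  next
    case vNil
    then show ?thesis by (auto dest: arg_cong[of _ _ dim_vec])
  qed
qed

lemma finite_carrier_vec_bit: "finite (carrier_vec n :: bit vec set)"
  by (induction n) (simp_all add: carrier_vec_bit_0 carrier_vec_bit_Suc)

lemma sum_carrier_vec_Suc:
  fixes f :: "bit vec \<Rightarrow> int"
  shows "(\<Sum>x\<in>carrier_vec (Suc n). f x) =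
    (\<Sum>x\<in>carrier_vec n. f (vCons 0 x) + f (vCons 1 x))"
proof -
  have inj: "inj_on (vCons a) (carrier_vec n)" for a :: bit
    by (auto intro: inj_onI)
  have "(\<Sum>x\<in>carrier_vec (Suc n). f x) =
      (\<Sum>x\<in>vCons 0 ` carrier_vec n. f x) + (\<Sum>x\<in>vCons 1 ` carrier_vec n. f x)"
    unfolding carrier_vec_bit_Suc
    by (rule sum.union_disjoint) (auto simp: finite_carrier_vec_bit)
  then show ?thesis by (simp add: sum.reindex[OF inj] sum.distrib)
qed

lemma card_carrier_vec_bit: "card (carrier_vec n :: bit vec set) = 2 ^ n"
proof -
  have "(\<Sum>x\<in>(carrier_vec n :: bit vec set). 1 :: int) = 2 ^ n"
  proof (induction n)
    case (Suc n)
    then show ?case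
      by (subst sum_carrier_vec_Suc) (simp only: sum.distrib, simp)
  qed (simp add: carrier_vec_bit_0)
  then have "int (card (carrier_vec n :: bit vec set)) = int (2 ^ n)" by simp
  then show ?thesis by (simp only: of_nat_eq_iff)
qed

section \<open>Gauss sums of the coordinate forms, one plane at a time\<close>

definition hyperbolic_form :: "nat \<Rightarrow> bit vec \<Rightarrow> bit" where
  "hyperbolic_form r x = (\<Sum>i<r. x $ (2 * i) * x $ (2 * i + 1))"

lemma hyperbolic_form_vCons:
  assumes "x \<in> carrier_vec (2 * r)"
  shows "hyperbolic_form (Suc r) (vCons a (vCons b x)) = a * b + hyperbolic_form r x"
proof -
  have "hyperbolic_form (Suc r) (vCons a (vCons b x)) = a * b +
      (\<Sum>i<r. vCons a (vCons b x) $ (2 * Suc i) * vCons a (vCons b x) $ (2 * Suc i + 1))"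
    unfolding hyperbolic_form_def sum.lessThan_Suc_shift by (simp add: vec_index_vCons)
  also have "\<dots> = a * b + hyperbolic_form r x"
    by (simp add: vec_index_vCons hyperbolic_form_def)
  finally show ?thesis .
qed

text \<open>On a single plane \<open>a * b\<close> takes the values 0, 0, 0, 1, so each plane
  contributes a factor 2.\<close>

lemma gauss_sum_hyperbolic:
  "(\<Sum>x\<in>carrier_vec (2 * r). chi (hyperbolic_form r x)) = 2 ^ r"
proof (induction r)
  case 0
  then show ?case by (simp add: carrier_vec_bit_0 hyperbolic_form_def)
next
  case (Suc r)
  have "(\<Sum>x\<in>carrier_vec (2 * Suc r). chi (hyperbolic_form (Suc r) x)) =
      (\<Sum>x\<in>carrier_vec (2 * r). 2 * chi (hyperbolic_form r x))"
    unfolding mult_Suc_right add_2_eq_Suc sum_carrier_vec_Suc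
    by (rule sum.cong) (simp_all add: hyperbolic_form_vCons chi_add)
  then show ?case using Suc by (simp flip: sum_distrib_left)
qed

definition elliptic_form :: "nat \<Rightarrow> bit vec \<Rightarrow> bit" where
  "elliptic_form r x = (x $ 0)\<^sup>2 + (x $ 1)\<^sup>2 + hyperbolic_form r x"

text \<open>The two squares make the first plane anisotropic:
  \<open>a\<^sup>2 + b\<^sup>2 + a * b\<close> takes the values 0, 1, 1, 1 and contributes the
  factor -2.\<close>

lemma gauss_sum_elliptic:
  "(\<Sum>x\<in>carrier_vec (2 * Suc r). chi (elliptic_form (Suc r) x)) = - (2 ^ Suc r)"
proof -
  have "(\<Sum>x\<in>carrier_vec (2 * Suc r). chi (elliptic_form (Suc r) x)) =
      (\<Sum>x\<in>carrier_vec (2 * r). - 2 * chi (hyperbolic_form r x))"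
    unfolding mult_Suc_right add_2_eq_Suc sum_carrier_vec_Suc
    by (rule sum.cong)
      (simp_all add: elliptic_form_def hyperbolic_form_vCons vec_index_vCons chi_add)
  then show ?thesis
    using gauss_sum_hyperbolic[of r] by (simp only: sum_distrib_left [symmetric]) simp
qed

section \<open>The bilinear form and its matrix\<close>

definition polar_form :: "nat \<Rightarrow> bit vec \<Rightarrow> bit vec \<Rightarrow> bit" where
  "polar_form r x y = (\<Sum>i<r. x $ (2 * i) * y $ (2 * i + 1) + x $ (2 * i + 1) * y $ (2 * i))"

lemma bit_add_square: "(a + b)\<^sup>2 = a\<^sup>2 + b\<^sup>2" for a b :: bit
  by (cases a; cases b) simp_all

text \<open>Squaring is additive in characteristic 2, so the two extra squares leave the
  polarisation unchanged.\<close>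

lemma elliptic_form_add:
  assumes "x \<in> carrier_vec (2 * r)" "y \<in> carrier_vec (2 * r)" "r > 0"
  shows "elliptic_form r (x + y) = elliptic_form r x + elliptic_form r y + polar_form r x y"
proof -
  have "hyperbolic_form r (x + y) =
      (\<Sum>i<r. (x $ (2 * i) * x $ (2 * i + 1) + y $ (2 * i) * y $ (2 * i + 1)) +
      (x $ (2 * i) * y $ (2 * i + 1) + x $ (2 * i + 1) * y $ (2 * i)))"
    unfolding hyperbolic_form_def
    by (rule sum.cong) (use assms in \<open>auto simp: algebra_simps\<close>)
  then have "hyperbolic_form r (x + y) =
      hyperbolic_form r x + hyperbolic_form r y + polar_form r x y"
    by (simp add: hyperbolic_form_def polar_form_def sum.distrib)
  moreover have "(x + y) $ 0 = x $ 0 + y $ 0" "(x + y) $ 1 = x $ 1 + y $ 1"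
    using assms by auto
  ultimately show ?thesis
    by (simp only: elliptic_form_def bit_add_square add_ac)
qed

lemma dim_M_form [simp]: "dim_row (M_form r) = 2 * r" "dim_col (M_form r) = 2 * r"
  by (induction r) (simp_all add: M_form_def Let_def mat_of_rows_list_def)

lemma index_M_form:
  assumes "i < 2 * r" "j < 2 * r"
  shows "M_form r $$ (i, j) = (if i div 2 = j div 2 \<and> i \<noteq> j then 1 else 0)"
  using assms
proof (induction r arbitrary: i j)
  case (Suc r)
  \<comment> \<open>The diagonal block, with \<open>-1\<close> written as \<open>1\<close>.\<close>
  let ?K = "mat_of_rows_list 2 [[0, 1], [1, 0]] :: bit mat"
  have K: "dim_row ?K = 2" "dim_col ?K = 2"
    by (simp_all add: mat_of_rows_list_def)
  have M: "M_form (Suc r) = four_block_mat ?K (0\<^sub>m 2 (2 * r)) (0\<^sub>m (2 * r) 2) (M_form r)"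
    using dim_M_form[of r] by (simp add: M_form_def Let_def K)
  have entries: "?K $$ (i, j) = (if i \<noteq> j then 1 else 0)" if "i < 2" "j < 2" for i j
    using that by (auto simp: mat_of_rows_list_def less_2_cases_iff)
  \<comment> \<open>Past the first block, indices drop by two and block numbers by one.\<close>
  have shift: "k div 2 = Suc ((k - 2) div 2)" if "\<not> k < 2" for k :: nat
    using that by (simp add: le_div_geq)
  show ?case
    using Suc by (auto simp: M K entries shift)
qed simp

text \<open>Multiplication by \<open>M_form r\<close> swaps the two coordinates of every
  pair.\<close>

lemma scalar_prod_M_form:
  assumes "x \<in> carrier_vec (2 * r)" "y \<in> carrier_vec (2 * r)"
  shows "x \<bullet> (M_form r *\<^sub>v y) = polar_form r x y"
proof -
  have My: "(M_form r *\<^sub>v y) $ i = (\<Sum>j<2 * r. (if i div 2 = j div 2 \<and> i \<noteq> j then y $ j else 0))"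
    if "i < 2 * r" for i
    using that assms
    by (auto simp: scalar_prod_def index_M_form lessThan_atLeast0 intro!: sum.cong)
  have even: "(M_form r *\<^sub>v y) $ (2 * i) = y $ (2 * i + 1)" if "i < r" for i
  proof -
    have "i = j div 2 \<and> 2 * i \<noteq> j \<longleftrightarrow> j = Suc (2 * i)" for j
      by presburger
    then show ?thesis using that by (simp add: My del: index_mult_mat_vec)
  qed
  have odd: "(M_form r *\<^sub>v y) $ (2 * i + 1) = y $ (2 * i)" if "i < r" for i
  proof -
    have "i = j div 2 \<and> Suc (2 * i) \<noteq> j \<longleftrightarrow> j = 2 * i" for j
      by presburger
    then show ?thesis using that by (simp add: My del: index_mult_mat_vec)
  qed
  have "x \<bullet> (M_form r *\<^sub>v y) = (\<Sum>i<2 * r. x $ i * (M_form r *\<^sub>v y) $ i)"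
    by (simp add: scalar_prod_def lessThan_atLeast0)
  also have "\<dots> = polar_form r x y"
    unfolding sum_pairs polar_form_def
    by (rule sum.cong) (use even odd in auto)
  finally show ?thesis .
qed

lemma polar_form_nondegenerate:
  assumes u: "u \<in> carrier_vec (2 * r)" "u \<noteq> 0\<^sub>v (2 * r)"
  shows "\<exists>e\<in>carrier_vec (2 * r). polar_form r e u = 1"
proof -
  have "\<exists>j<2 * r. u $ j \<noteq> 0"
  proof (rule ccontr)
    assume "\<not> (\<exists>j<2 * r. u $ j \<noteq> 0)"
    then have "u = 0\<^sub>v (2 * r)"
      using u(1) by (intro eq_vecI) auto
    then show False using u(2) by simp
  qed
  then obtain j where j: "j < 2 * r" "u $ j \<noteq> 0"
    by blast
  define m where "m = j div 2"
  have m: "m < r" using j by (auto simp: m_def)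
  \<comment> \<open>The partner of \<open>j\<close> in its pair: the unit vector at \<open>p\<close>
    extracts \<open>u $ j\<close>, which is 1 because it is a nonzero bit.\<close>
  define p where "p = (if even j then j + 1 else j - 1)"
  have "polar_form r (unit_vec (2 * r) p) u = (\<Sum>i<r. if i = m then u $ j else 0)"
    unfolding polar_form_def
  proof (rule sum.cong)
    fix i assume "i \<in> {..<r}"
    then show "unit_vec (2 * r) p $ (2 * i) * u $ (2 * i + 1) +
        unit_vec (2 * r) p $ (2 * i + 1) * u $ (2 * i) = (if i = m then u $ j else 0)"
      using j by (cases "even j") (auto simp: p_def m_def elim!: evenE oddE)
  qed simp
  then have "polar_form r (unit_vec (2 * r) p) u = 1"
    using m j by (simp add: sum.delta)
  then show ?thesis by (intro bexI[of _ "unit_vec (2 * r) p"]) auto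
qed

text \<open>With \<open>q = 2 ^ (r - 2)\<close> the space has \<open>4 ^ r = 16 * q\<^sup>2\<close>
  vectors and the Gauss sum is \<open>- (2 ^ r) = - 4 * q\<close>.\<close>

lemma elliptic_quadratic_space:
  assumes r: "r \<ge> 2"
  shows "quadratic_space (carrier_vec (2 * r)) (0\<^sub>v (2 * r)) (elliptic_form r) (polar_form r)
    (2 ^ (r - 2))"
proof
  show "polar_form r x y = polar_form r y x" for x y
    unfolding polar_form_def by (rule sum.cong) (simp_all add: ac_simps)
  show "polar_form r x (y + z) = polar_form r x y + polar_form r x z"
    if "x \<in> carrier_vec (2 * r)" "y \<in> carrier_vec (2 * r)" "z \<in> carrier_vec (2 * r)" for x y z
  proof -
    have "polar_form r x (y + z) =
        (\<Sum>i<r. (x $ (2 * i) * y $ (2 * i + 1) + x $ (2 * i + 1) * y $ (2 * i)) +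
        (x $ (2 * i) * z $ (2 * i + 1) + x $ (2 * i + 1) * z $ (2 * i)))"
      unfolding polar_form_def
      by (rule sum.cong) (use that in \<open>auto simp: algebra_simps\<close>)
    then show ?thesis by (simp add: polar_form_def sum.distrib)
  qed
  show "elliptic_form r (x + y) = elliptic_form r x + elliptic_form r y + polar_form r x y"
    if "x \<in> carrier_vec (2 * r)" "y \<in> carrier_vec (2 * r)" for x y
    using elliptic_form_add that r by simp
  show "elliptic_form r (0\<^sub>v (2 * r)) = 0"
    using r by (simp add: elliptic_form_def hyperbolic_form_def)
  show "\<exists>e\<in>carrier_vec (2 * r). polar_form r e u = 1"
    if "u \<in> carrier_vec (2 * r)" "u \<noteq> 0\<^sub>v (2 * r)" for u
    using that by (rule polar_form_nondegenerate)
  obtain s where s: "r = s + 2" using r le_Suc_ex[of 2 r] by auto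
  show "card (carrier_vec (2 * r) :: bit vec set) = 16 * (2 ^ (r - 2))\<^sup>2"
    by (simp add: card_carrier_vec_bit s power_add power_mult mult.commute power2_eq_square
        flip: power_mult_distrib)
  show "(\<Sum>z\<in>carrier_vec (2 * r). chi (elliptic_form r z)) = - 4 * int (2 ^ (r - 2))"
    using gauss_sum_elliptic[of "Suc s"] by (simp add: s)
  show "x + x = 0\<^sub>v (2 * r)" if "x \<in> carrier_vec (2 * r)" for x :: "bit vec"
    by (rule eq_vecI) (use that in auto)
qed (simp_all add: finite_carrier_vec_bit comm_add_vec)

lemma quadratic_space_V_elliptic:
  assumes r: "r \<ge> 2"
  shows "quadratic_space.V (carrier_vec (2 * r)) (elliptic_form r) = elliptic_quadric r"
  unfolding quadratic_space.V_def[OF elliptic_quadratic_space[OF r]]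
  by (simp add: elliptic_quadric_def elliptic_form_def hyperbolic_form_def)

theorem proposition7p1:
  fixes r k lam :: nat
  assumes "r \<ge> 3"
    and "k = 2 ^ (2 * r - 2) + 2 ^ (r - 1)"
    and "lam = 2 ^ (2 * r - 3) + 2 ^ (r - 2)"
  shows "kappa2 (with_proj (elliptic_quadric_graph r))
           = enat (3 * (2 ^ (2 * r - 3) + 2 ^ (r - 2)) - 3)
       \<and> 3 * (2 ^ (2 * r - 3) + 2 ^ (r - 2)) - 3 = 2 * k - lam - 3"
proof -
  have r2: "r \<ge> 2" using assms(1) by simp
  \<comment> \<open>Substituting \<open>t + 3\<close> removes the truncated subtractions from all
    exponents.\<close>
  obtain t where t: "r = t + 3"
    using le_Suc_ex[OF assms(1)] by (auto simp: add.commute)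
  define q :: nat where "q = 2 ^ (r - 2)"
  interpret quadratic_space "carrier_vec (2 * r)" "0\<^sub>v (2 * r)" "elliptic_form r" "polar_form r" q
    unfolding q_def by (rule elliptic_quadratic_space[OF r2])
  let ?G = "with_proj (elliptic_quadric_graph r)"
  have V: "V = elliptic_quadric r"
    by (rule quadratic_space_V_elliptic[OF r2])
  have form: "x \<bullet> (M_form r *\<^sub>v y) = polar_form r x y" if "x \<in> V" "y \<in> V" for x y
    using that by (intro scalar_prod_M_form) simp_all
  have arcs: "arcs_ends ?G = {(x, y). x \<in> V \<and> y \<in> V \<and> polar_form r x y = 1}"
    using form by (auto simp: elliptic_quadric_graph_def V)
  have "sym_digraph ?G"
  proof
    show "symmetric ?G"
      unfolding symmetric_def arcs using B_sym by (auto intro!: symI)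
  qed (auto simp: elliptic_quadric_graph_def)
  \<comment> \<open>Here \<open>q = 2 ^ (t + 1)\<close>.\<close>
  moreover have "q = 2 \<or> q \<ge> 4"
  proof (cases t)
    case (Suc n)
    then show ?thesis by (simp add: q_def t)
  qed (simp add: q_def t)
  ultimately have "kappa2 ?G = enat (6 * q\<^sup>2 + 3 * q - 3)"
    using arcs by (intro kappa2_eq) (auto simp: elliptic_quadric_graph_def V)
  moreover have "6 * q\<^sup>2 + 3 * q = 3 * (2 ^ (2 * r - 3) + 2 ^ (r - 2))"
    by (simp add: q_def t power_add power_mult power2_eq_square flip: power_mult_distrib)
  moreover have "2 * k - lam = 3 * (2 ^ (2 * r - 3) + 2 ^ (r - 2))"
    by (simp add: assms(2,3) t power_add)
  ultimately show ?thesis by simp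
qed

end
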